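(* Let $n\in\mathbb{N}$ with $n\ge 1$ and let $G$ be a graph containing a Type-1 neighbourhood chain (NC-T1) of length $2n$. Then $G$ is a non-distance magic (NDM) graph.
   Context: All graphs are finite, undirected and simple. For a graph $G$ and $u\in V(G)$, $N(u)=\{v\in V(G): uv\in E(G)\}$ and $N[u]=N(u)\cup\{u\}$. Distance magic. Let $G$ be a graph with $p$ vertices. A bijection $f:V(G)\to\{1,2,\dots,p\}$ is a distance magic labeling of $G$ if $\sum_{v\in N(u)}f(v)$ is the same constant $S$ for all $u\in V(G)$. $G$ is a distance magic graph if it has a distance magic labeling; otherwise it is non-distance magic (NDM). Neighbourhood chain. Let $\ell\ge 2$, let $u_1,\dots,u_\ell\in V(G)$ with $|N[u_i]|>1$ for all $i$, and put $N_i=N(u_i)$. The sequence $N_1N_2\cdots N_\ell$ is a neighbourhood chain of length $\ell$ in $G$ if $N_i\cap N_{i+1}\neq\emptyset$ for $1\le i\le \ell-1$, and non-consecutive terms other than the pair (first, last) are disjoint, i.e. $N_i\cap N_j=\emptyset$ whenever $1<|i-j|<\ell-1$ (no such restriction is placed on the pair $N_1,N_\ell$). Type 1 (NC-T1). Let $\ell\ge 2$ and $m\ge \ell+1$. Let $\{u_1,\dots,u_\ell\}$ and $\{v_1,\dots,v_m\}$ be disjoint subsets of $V(G)$ with $u_1\ne u_\ell$ and $v_1,\dots,v_m$ pairwise distinct, such that for each $i$, $N_i=N(u_i)=\{v_j : 1\le j\le m,\ u_iv_j\in E(G)\}\neq\emptyset$ (so all neighbours of every $u_i$ lie among the $v_j$).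 A neighbourhood chain $N_1N_2\cdots N_\ell$ in $G$ is of Type 1 (an NC-T1 of length $\ell$) if (i) $N_1\setminus N_2=\{v_1\}$ and $N_\ell\setminus N_{\ell-1}=\{v_\ell\}$; (ii) $N_{i+1}\setminus N_i\subseteq N_{i+2}$ for $i=1,\dots,\ell-2$, and $|N_i\setminus N_{i+1}|\ge 1$ and $|N_{i+1}\setminus N_i|\ge 1$ for $i=1,\dots,\ell-1$. *)

theory Defs
  imports "Graph_Theory.Digraph"
begin

text \<open>
  A finite undirected simple graph is an instance of the locale \<open>graph\<close>: a finite, loop-free,
  symmetric digraph without parallel arcs, so that \<open>u \<rightarrow>\<^bsub>G\<^esub> v\<close> says that
  \<open>uv\<close> is an edge.
\<close>

definition nbhd :: "('a, 'b) pre_digraph \<Rightarrow> 'a \<Rightarrow> 'a set" where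
  "nbhd G u = {v \<in> verts G. u \<rightarrow>\<^bsub>G\<^esub> v}"

definition closed_nbhd :: "('a, 'b) pre_digraph \<Rightarrow> 'a \<Rightarrow> 'a set" where
  "closed_nbhd G u = nbhd G u \<union> {u}"

definition distance_magic_labeling :: "('a, 'b) pre_digraph \<Rightarrow> ('a \<Rightarrow> nat) \<Rightarrow> bool" where
  "distance_magic_labeling G f \<longleftrightarrow>
     bij_betw f (verts G) {1..card (verts G)} \<and>
     (\<exists>S. \<forall>u \<in> verts G. (\<Sum>v \<in> nbhd G u. f v) = S)"

definition distance_magic :: "('a, 'b) pre_digraph \<Rightarrow> bool" where
  "distance_magic G \<longleftrightarrow> (\<exists>f. distance_magic_labeling G f)"

definition non_distance_magic :: "('a, 'b) pre_digraph \<Rightarrow> bool" where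
  "non_distance_magic G \<longleftrightarrow> \<not> distance_magic G"

text \<open>
  Finite sequences \<open>u\<^sub>1, \<dots>, u\<^sub>\<ell>\<close> are functions on \<open>nat\<close> of which only the values at
  \<open>1, \<dots>, \<ell>\<close> matter. The \<open>u\<^sub>i\<close> need not be pairwise distinct. Indices are compared in
  \<open>int\<close> because subtraction on \<open>nat\<close> is truncated.
\<close>

definition nbhd_chain :: "('a, 'b) pre_digraph \<Rightarrow> nat \<Rightarrow> (nat \<Rightarrow> 'a) \<Rightarrow> bool" where
  "nbhd_chain G l u \<longleftrightarrow>
     l \<ge> 2 \<and>
     (\<forall>i \<in> {1..l}. u i \<in> verts G \<and> card (closed_nbhd G (u i)) > 1) \<and>
     (\<forall>i \<in> {1..l - 1}. nbhd G (u i) \<inter> nbhd G (u (i + 1)) \<noteq> {}) \<and>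
     (\<forall>i \<in> {1..l}. \<forall>j \<in> {1..l}.
        1 < \<bar>int i - int j\<bar> \<and> \<bar>int i - int j\<bar> < int l - 1 \<longrightarrow>
        nbhd G (u i) \<inter> nbhd G (u j) = {})"

definition nc_t1 ::
  "('a, 'b) pre_digraph \<Rightarrow> nat \<Rightarrow> nat \<Rightarrow> (nat \<Rightarrow> 'a) \<Rightarrow> (nat \<Rightarrow> 'a) \<Rightarrow> bool" where
  "nc_t1 G l m u v \<longleftrightarrow>
     l \<ge> 2 \<and> m \<ge> l + 1 \<and>
     u ` {1..l} \<subseteq> verts G \<and> v ` {1..m} \<subseteq> verts G \<and>
     u ` {1..l} \<inter> v ` {1..m} = {} \<and>
     u 1 \<noteq> u l \<and> inj_on v {1..m} \<and>
     (\<forall>i \<in> {1..l}.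
        nbhd G (u i) = {v j | j. j \<in> {1..m} \<and> u i \<rightarrow>\<^bsub>G\<^esub> v j} \<and> nbhd G (u i) \<noteq> {}) \<and>
     nbhd_chain G l u \<and>
     nbhd G (u 1) - nbhd G (u 2) = {v 1} \<and>
     nbhd G (u l) - nbhd G (u (l - 1)) = {v l} \<and>
     (\<forall>i \<in> {1..l - 2}. nbhd G (u (i + 1)) - nbhd G (u i) \<subseteq> nbhd G (u (i + 2))) \<and>
     (\<forall>i \<in> {1..l - 1}.
        card (nbhd G (u i) - nbhd G (u (i + 1))) \<ge> 1 \<and>
        card (nbhd G (u (i + 1)) - nbhd G (u i)) \<ge> 1)"

definition contains_nc_t1 :: "('a, 'b) pre_digraph \<Rightarrow> nat \<Rightarrow> bool" where
  "contains_nc_t1 G l \<longleftrightarrow> (\<exists>m u v. nc_t1 G l m u v)"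

end

theory Submission
  imports Defs
begin

text \<open>
  Put \<open>B\<^sub>i = N\<^sub>i \<inter> N\<^sub>i\<^sub>+\<^sub>1\<close>. Every inner \<open>N\<^sub>i\<^sub>+\<^sub>1\<close> is the disjoint union of
  \<open>B\<^sub>i\<close> and \<open>B\<^sub>i\<^sub>+\<^sub>1\<close>, so a labeling with constant neighbourhood sum \<open>S\<close> has alternating
  weights on \<open>B\<^sub>1, B\<^sub>2, \<dots>\<close>. For even length \<open>\<ell>\<close> the sets \<open>B\<^sub>1\<close> and
  \<open>B\<^sub>\<ell>\<^sub>-\<^sub>1\<close> therefore have equal weight. As \<open>N\<^sub>1\<close> and \<open>N\<^sub>\<ell>\<close> arise from them by adding
  \<open>v\<^sub>1\<close> and \<open>v\<^sub>\<ell>\<close> respectively, these two distinct vertices get the same label.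
\<close>

text \<open>One inclusion is the chain condition; the other holds because
  \<open>nbhd G (u i)\<close> and \<open>nbhd G (u (i + 2))\<close> are disjoint. For
  \<open>l = 3\<close> these would be the exempt first and last terms, hence
  \<open>l \<ge> 4\<close>.\<close>

lemma nc_t1_inner_nbhd:
  assumes "nc_t1 G l m u v" and "l \<ge> 4" and "i \<in> {1..l - 2}"
  shows "nbhd G (u (i + 1)) - nbhd G (u i) = nbhd G (u (i + 1)) \<inter> nbhd G (u (i + 2))"
proof -
  have "nbhd G (u (i + 1)) - nbhd G (u i) \<subseteq> nbhd G (u (i + 2))"
    using assms by (simp add: nc_t1_def)
  moreover have "nbhd G (u i) \<inter> nbhd G (u (i + 2)) = {}"
  proof -
    have "i \<in> {1..l}" "i + 2 \<in> {1..l}"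
      "1 < \<bar>int i - int (i + 2)\<bar>" "\<bar>int i - int (i + 2)\<bar> < int l - 1"
      using assms by auto
    moreover have "nbhd_chain G l u"
      using assms by (simp add: nc_t1_def)
    ultimately show ?thesis
      unfolding nbhd_chain_def by blast
  qed
  ultimately show ?thesis by blast
qed

lemma sum_nc_t1_overlap:
  fixes f :: "'a \<Rightarrow> nat"
  assumes nc: "nc_t1 G l m u v" and fin: "finite (verts G)"
    and S: "\<And>x. x \<in> verts G \<Longrightarrow> sum f (nbhd G x) = S"
    and k: "2 * k + 2 \<le> l"
  shows "sum f (nbhd G (u (2 * k + 1)) \<inter> nbhd G (u (2 * k + 2))) =
         sum f (nbhd G (u 1) \<inter> nbhd G (u 2))"
  using k
proof (induction k)
  case 0
  then show ?case by (simp add: numeral_2_eq_2)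
next
  case (Suc k)
  let ?B = "\<lambda>i. sum f (nbhd G (u i) \<inter> nbhd G (u (i + 1)))"
  \<comment> \<open>Proved inside the induction step, where the bound on \<open>Suc k\<close> gives
    \<open>l \<ge> 4\<close>.\<close>
  have step: "?B i + ?B (i + 1) = S" if i: "i \<in> {1..l - 2}" for i
  proof -
    have "u (i + 1) \<in> verts G"
      using nc i by (auto simp: nc_t1_def)
    moreover have "finite (nbhd G (u (i + 1)))"
      using fin by (simp add: nbhd_def)
    then have "sum f (nbhd G (u (i + 1))) =
        sum f (nbhd G (u (i + 1)) \<inter> nbhd G (u i)) + sum f (nbhd G (u (i + 1)) - nbhd G (u i))"
      by (rule sum.Int_Diff)
    moreover have "nbhd G (u (i + 1)) - nbhd G (u i) = nbhd G (u (i + 1)) \<inter> nbhd G (u (i + 2))"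
      using nc_t1_inner_nbhd[OF nc _ i] Suc.prems by simp
    ultimately show ?thesis
      using S by (simp add: Int_commute)
  qed
  have "2 * k + 1 \<in> {1..l - 2}" "2 * k + 2 \<in> {1..l - 2}"
    using Suc.prems by auto
  \<comment> \<open>Both sums contain \<open>?B (2 * k + 2)\<close>, which cancels.\<close>
  from step[OF this(1)] step[OF this(2)] have "?B (2 * k + 3) = ?B (2 * k + 1)"
    by (simp add: eval_nat_numeral)
  then show ?case
    using Suc by (simp add: eval_nat_numeral)
qed

theorem theorem3p6:
  fixes G :: "('a, 'b) pre_digraph" and n :: nat
  assumes "graph G"
    and "n \<ge> 1"
    and "contains_nc_t1 G (2 * n)"
  shows "non_distance_magic G"
  unfolding non_distance_magic_def distance_magic_def
proof
  assume "\<exists>f. distance_magic_labeling G f"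
  then obtain f S where bij: "bij_betw f (verts G) {1..card (verts G)}"
    and S: "\<And>x. x \<in> verts G \<Longrightarrow> sum f (nbhd G x) = S"
    by (auto simp: distance_magic_labeling_def)
  interpret graph G by fact
  obtain m u v where nc: "nc_t1 G (2 * n) m u v"
    using assms(3) by (auto simp: contains_nc_t1_def)
  have ends: "sum f (nbhd G x \<inter> nbhd G y) + f w = S"
    if "x \<in> verts G" "nbhd G x - nbhd G y = {w}" for x y w
  proof -
    have "finite (nbhd G x)" by (simp add: nbhd_def)
    from sum.Int_Diff[OF this, of f "nbhd G y"] show ?thesis
      using that S by simp
  qed
  have le: "2 * n + 1 \<le> m"
    and uv: "u ` {1..2 * n} \<subseteq> verts G" "v ` {1..m} \<subseteq> verts G"
    and inj: "inj_on v {1..m}"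
    and diffs: "nbhd G (u 1) - nbhd G (u 2) = {v 1}"
      "nbhd G (u (2 * n)) - nbhd G (u (2 * n - 1)) = {v (2 * n)}"
    using nc unfolding nc_t1_def by - (elim conjE, assumption)+
  have "1 \<in> {1..2 * n}" "2 * n \<in> {1..2 * n}" and idx: "1 \<in> {1..m}" "2 * n \<in> {1..m}"
    using le \<open>n \<ge> 1\<close> by auto
  then have verts: "u 1 \<in> verts G" "u (2 * n) \<in> verts G" "v 1 \<in> verts G" "v (2 * n) \<in> verts G"
    using uv by blast+
  note end_sums = ends[OF verts(1) diffs(1)] ends[OF verts(2) diffs(2)]
  have "sum f (nbhd G (u (2 * n - 1)) \<inter> nbhd G (u (2 * n))) =
      sum f (nbhd G (u 1) \<inter> nbhd G (u 2))"
    \<comment> \<open>For \<open>k = n - 1\<close> the overlap is that of the last two terms; here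
      the even length enters.\<close>
    using sum_nc_t1_overlap[OF nc finite_verts S, of "n - 1"] \<open>n \<ge> 1\<close>
    by (cases n) auto
  then have "f (v 1) = f (v (2 * n))"
    using end_sums by (simp add: Int_commute)
  then have "v 1 = v (2 * n)"
    using inj_onD[OF bij_betw_imp_inj_on[OF bij]] verts by blast
  then have "1 = 2 * n"
    using inj_onD[OF inj] idx by blast
  then show False by presburger
qed

end
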